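(* $gr^3_2(B_{11})=19$.
   Context: $K_n$ is the complete graph of order $n$. The book $B_n:=K_2+nK_1$ (graph join) is the graph on $n+2$ vertices consisting of an edge $xy$ (the spine) together with $n$ further, pairwise non-adjacent vertices (the pages), each adjacent to both $x$ and $y$. A $t$-coloring of $K_p$ is a map $f:E(K_p)\to\{1,\dots,t\}$, not assumed surjective. A Gallai $t$-coloring is a $t$-coloring with no rainbow triangle, i.e. there are no three vertices $x,y,z$ such that $f(xy),f(xz),f(yz)$ are pairwise distinct. For $1\le s<t$ and a graph $G$, the weakened Gallai-Ramsey number $gr^t_s(G)$ is the least $p\in\mathbb{N}$ such that every Gallai $t$-coloring of $K_p$ contains a (not necessarily induced) subgraph isomorphic to $G$ whose edges use at most $s$ colors. *)

theory Defs
  imports "HOL-Library.Extended_Nat" "HOL-Library.FuncSet"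
begin

text \<open>Finite simple graphs. Edges are two-element sets of vertices.\<close>

record 'a graph =
  verts :: "'a set"
  edges :: "'a set set"

definition simple_graph :: "'a graph \<Rightarrow> bool" where
  "simple_graph G \<longleftrightarrow> finite (verts G) \<and> (\<forall>e\<in>edges G. e \<subseteq> verts G \<and> card e = 2)"

definition subgraph :: "'a graph \<Rightarrow> 'a graph \<Rightarrow> bool" where
  "subgraph H G \<longleftrightarrow> simple_graph H \<and> verts H \<subseteq> verts G \<and> edges H \<subseteq> edges G"

definition isomorphic :: "'a graph \<Rightarrow> 'b graph \<Rightarrow> bool" where
  "isomorphic G H \<longleftrightarrow>
    (\<exists>\<phi>. bij_betw \<phi> (verts G) (verts H) \<and>
         (\<forall>u\<in>verts G. \<forall>v\<in>verts G. {u, v} \<in> edges G \<longleftrightarrow> {\<phi> u, \<phi> v} \<in> edges H))"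

definition complete_graph :: "nat \<Rightarrow> nat graph" where
  "complete_graph n = \<lparr>verts = {..<n}, edges = {e. e \<subseteq> {..<n} \<and> card e = 2}\<rparr>"

text \<open>The disjoint union \<open>nG\<close> of \<open>n\<close> copies of \<open>G\<close>.\<close>

definition copies :: "nat \<Rightarrow> 'a graph \<Rightarrow> (nat \<times> 'a) graph" where
  "copies n G =
    \<lparr>verts = {..<n} \<times> verts G,
     edges = {{(i, u), (i, v)} | i u v. i < n \<and> {u, v} \<in> edges G}\<rparr>"

definition graph_join :: "'a graph \<Rightarrow> 'b graph \<Rightarrow> ('a + 'b) graph" where
  "graph_join G H =
    \<lparr>verts = verts G <+> verts H,
     edges = (\<lambda>e. Inl ` e) ` edges G \<union> (\<lambda>e. Inr ` e) ` edges H
           \<union> {{Inl u, Inr v} | u v. u \<in> verts G \<and> v \<in> verts H}\<rparr>"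

definition book :: "nat \<Rightarrow> (nat + nat \<times> nat) graph" where
  "book n = graph_join (complete_graph 2) (copies n (complete_graph 1))"

definition coloring :: "nat \<Rightarrow> nat \<Rightarrow> (nat set \<Rightarrow> nat) \<Rightarrow> bool" where
  "coloring t p f \<longleftrightarrow> f \<in> edges (complete_graph p) \<rightarrow> {1..t}"

definition rainbow_triangle :: "nat \<Rightarrow> (nat set \<Rightarrow> nat) \<Rightarrow> bool" where
  "rainbow_triangle p f \<longleftrightarrow>
    (\<exists>x\<in>verts (complete_graph p). \<exists>y\<in>verts (complete_graph p). \<exists>z\<in>verts (complete_graph p).
      distinct [x, y, z] \<and> distinct [f {x, y}, f {x, z}, f {y, z}])"

definition gallai_coloring :: "nat \<Rightarrow> nat \<Rightarrow> (nat set \<Rightarrow> nat) \<Rightarrow> bool" where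
  "gallai_coloring t p f \<longleftrightarrow> coloring t p f \<and> \<not> rainbow_triangle p f"

text \<open>The infimum is taken in \<^typ>\<open>enat\<close>, so that a finite value \<open>n\<close> means that \<open>n\<close> has the
  property and is the least such number; the value would be \<open>\<infinity>\<close> if no number had it.
  The intended parameter range is \<open>1 \<le> s < t\<close>.\<close>

definition weakened_gallai_ramsey :: "nat \<Rightarrow> nat \<Rightarrow> 'a graph \<Rightarrow> enat" where
  "weakened_gallai_ramsey t s G =
    Inf (enat ` {p. \<forall>f. gallai_coloring t p f \<longrightarrow>
      (\<exists>H. subgraph H (complete_graph p) \<and> isomorphic H G \<and> card (f ` edges H) \<le> s)})"

end

theory Submission
  imports Defs
begin

text \<open>
  Fix a colour \<open>k\<close> and an edge \<open>xy\<close> not coloured \<open>k\<close>. The book with spine \<open>xy\<close> avoiding \<open>k\<close> has all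
  vertices outside \<open>N\<^sub>k(x) \<union> N\<^sub>k(y)\<close> as possible pages, so a Gallai 3-colouring of \<open>K\<^sub>1\<^sub>9\<close> without a
  2-coloured \<open>B\<^sub>1\<^sub>1\<close> satisfies \<open>|N\<^sub>k(x) \<union> N\<^sub>k(y)| \<ge> 7\<close> for all such \<open>k\<close>, \<open>x\<close>, \<open>y\<close>.

  In a Gallai 3-colouring some colour \<open>k\<close> has a disconnected graph, and its components are joined
  pairwise monochromatically. Two components together have at least 9 vertices, which leaves
  either four cliques of orders 4, 5, 5, 5 or at most three components. Four cliques are
  impossible: one of the other colours joins a given clique to at most one other clique, which is
  too few neighbours. With at most three components \<open>V\<close> splits into \<open>A\<close> and \<open>B\<close> joined in a single
  colour, \<open>|A| \<le> 9\<close>. If \<open>|A| \<ge> 2\<close>, the bound forces \<open>|A| = 9\<close> and then a 2-colouring of \<open>A\<close> without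
  monochromatic triangle, contradicting \<open>R(3,3) = 6\<close>. If \<open>|A| = 1\<close>, the joining colour partitions the
  18 vertices of \<open>B\<close> into cliques of order 4, but 4 does not divide 18.

  For the lower bound, colour two copies of \<open>K\<^sub>9\<close> by the Paley graph on 9 vertices (the \<open>3 \<times> 3\<close> rook
  graph) and its complement, and all edges between the copies with the third colour.
\<close>

section \<open>Gallai colourings and disconnected colours\<close>

text \<open>The curried form on an arbitrary vertex set lets vertices be removed in an induction.
  Symmetry holds on the whole type, so it rewrites without membership conditions.\<close>

definition gallai3 :: "'a set \<Rightarrow> ('a \<Rightarrow> 'a \<Rightarrow> nat) \<Rightarrow> bool" where
  "gallai3 V c \<longleftrightarrow> finite V \<and> (\<forall>x y. c x y = c y x) \<and>
    (\<forall>x\<in>V. \<forall>y\<in>V. x \<noteq> y \<longrightarrow> c x y \<in> {1, 2, 3}) \<and>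
    (\<forall>x\<in>V. \<forall>y\<in>V. \<forall>z\<in>V. distinct [x, y, z] \<longrightarrow> \<not> distinct [c x y, c x z, c y z])"

definition nbrs :: "'a set \<Rightarrow> ('a \<Rightarrow> 'a \<Rightarrow> nat) \<Rightarrow> nat \<Rightarrow> 'a \<Rightarrow> 'a set" where
  "nbrs V c k x = {z \<in> V. z \<noteq> x \<and> c x z = k}"

text \<open>On \<open>V\<close> the reflexive transitive closure means lying in the same component
  of the graph of colour \<open>k\<close>.\<close>

definition link :: "'a set \<Rightarrow> ('a \<Rightarrow> 'a \<Rightarrow> nat) \<Rightarrow> nat \<Rightarrow> ('a \<times> 'a) set" where
  "link V c k = {(x, y). x \<in> V \<and> y \<in> V \<and> x \<noteq> y \<and> c x y = k}"

lemma gallai3_finite: "gallai3 V c \<Longrightarrow> finite V"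
  by (simp add: gallai3_def)

lemma gallai3_sym: "gallai3 V c \<Longrightarrow> c x y = c y x"
  by (simp add: gallai3_def)

lemma gallai3_range: "gallai3 V c \<Longrightarrow> x \<in> V \<Longrightarrow> y \<in> V \<Longrightarrow> x \<noteq> y \<Longrightarrow> c x y \<in> {1, 2, 3}"
  unfolding gallai3_def by blast

lemma gallai3_triangle:
  assumes "gallai3 V c" "x \<in> V" "y \<in> V" "z \<in> V" "x \<noteq> y" "x \<noteq> z" "y \<noteq> z"
  shows "c x y = c x z \<or> c x y = c y z \<or> c x z = c y z"
proof -
  have "distinct [x, y, z] \<longrightarrow> \<not> distinct [c x y, c x z, c y z]"
    using assms(1-4) unfolding gallai3_def by blast
  then show ?thesis using assms(5-7) by auto
qed

lemma gallai3_subset: "gallai3 V c \<Longrightarrow> W \<subseteq> V \<Longrightarrow> gallai3 W c"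
  unfolding gallai3_def by (meson finite_subset subsetD)

lemma link_rtrancl_sym:
  assumes "gallai3 V c" "(x, y) \<in> (link V c k)\<^sup>*"
  shows "(y, x) \<in> (link V c k)\<^sup>*"
proof -
  have "sym (link V c k)"
    using gallai3_sym[OF assms(1)] by (auto simp: sym_def link_def)
  then show ?thesis using assms(2) by (meson sym_rtrancl symD)
qed

lemma link_rtrancl_in: "(x, y) \<in> (link V c k)\<^sup>* \<Longrightarrow> x \<in> V \<Longrightarrow> y \<in> V"
  by (induction rule: rtrancl_induct) (auto simp: link_def)

lemma not_linked_color:
  assumes "x \<in> V" "y \<in> V" "(x, y) \<notin> (link V c k)\<^sup>*"
  shows "x \<noteq> y" "c x y \<noteq> k"
proof -
  show "x \<noteq> y" using assms(3) by blast
  then show "c x y \<noteq> k" using assms r_into_rtrancl[of "(x, y)" "link V c k"] by (auto simp: link_def)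
qed

text \<open>Each step of a \<open>k\<close>-coloured path from \<open>y\<close> to \<open>z\<close>
  forms with \<open>x\<close> a triangle with one edge of colour \<open>k\<close> and two of other
  colours. These two agree, since the triangle is not rainbow.\<close>

lemma color_to_component_const:
  assumes g: "gallai3 V c" and x: "x \<in> V" and y: "y \<in> V"
    and yz: "(y, z) \<in> (link V c k)\<^sup>*" and xy: "(x, y) \<notin> (link V c k)\<^sup>*"
  shows "c x z = c x y"
  using yz
proof (induction rule: rtrancl_induct)
  case base
  show ?case ..
next
  case (step u v)
  have uv: "u \<in> V" "v \<in> V" "u \<noteq> v" "c u v = k" using step.hyps(2) by (auto simp: link_def)
  have "(y, v) \<in> (link V c k)\<^sup>*" using step.hyps by (rule rtrancl_into_rtrancl)
  then have "(x, u) \<notin> (link V c k)\<^sup>*" "(x, v) \<notin> (link V c k)\<^sup>*"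
    using xy step.hyps(1) link_rtrancl_sym[OF g] by (meson rtrancl_trans)+
  then have "x \<noteq> u" "c x u \<noteq> k" "x \<noteq> v" "c x v \<noteq> k"
    using not_linked_color[OF x uv(1)] not_linked_color[OF x uv(2)] by auto
  then have "c x u = c x v" using gallai3_triangle[OF g x uv(1,2)] uv(3,4) by auto
  then show ?case using step.IH by simp
qed

lemma isolated_not_linked:
  assumes "v \<noteq> u" "\<And>z. z \<in> V \<Longrightarrow> z \<noteq> v \<Longrightarrow> c v z \<noteq> k"
  shows "(v, u) \<notin> (link V c k)\<^sup>*"
proof
  assume "(v, u) \<in> (link V c k)\<^sup>*"
  then obtain w where "(v, w) \<in> link V c k" using assms(1) by (meson converse_rtranclE)
  then show False using assms(2) by (auto simp: link_def)
qed

lemma other_colors: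
  assumes "k \<in> {1, 2, 3::nat}"
  obtains i j where "{1, 2, 3} = {i, j, k}" "i \<noteq> j" "i \<noteq> k" "j \<noteq> k"
proof -
  consider "k = 1" | "k = 2" | "k = 3" using assms by auto
  then show ?thesis
  proof cases
    case 1 then show ?thesis using that[of 2 3] by auto
  next
    case 2 then show ?thesis using that[of 1 3] by auto
  next
    case 3 then show ?thesis using that[of 1 2] by auto
  qed
qed

text \<open>Gallai's theorem for three colours, by adding a vertex \<open>v\<close>. If all colours
  became connected, \<open>v\<close> would send the colour \<open>k\<close> disconnected on
  \<open>F\<close> into each of its components. Edges of the two other colours at \<open>v\<close>
  then force conflicting colours between components.\<close>

lemma disconnected_color:
  assumes "finite V" "gallai3 V c" "card V \<ge> 2"
  shows "\<exists>k\<in>{1, 2, 3}. \<exists>x\<in>V. \<exists>y\<in>V. (x, y) \<notin> (link V c k)\<^sup>*"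
  using assms
proof (induction V rule: finite_induct)
  case empty
  then show ?case by simp
next
  case (insert v F)
  let ?L = "\<lambda>k. (link F c k)\<^sup>*" and ?M = "\<lambda>k. (link (insert v F) c k)\<^sup>*"
  note g = insert.prems(1)
  have gF: "gallai3 F c" by (rule gallai3_subset[OF g]) auto
  have "F \<noteq> {}" using insert.prems(2) by auto
  show ?case
  proof (rule ccontr)
    assume "\<not> ?case"
    then have conn: "(x, y) \<in> ?M k" if "k \<in> {1, 2, 3}" "x \<in> insert v F" "y \<in> insert v F" for k x y
      using that by blast
    have v_edge: "\<exists>u\<in>F. c v u = k" if "k \<in> {1, 2, 3}" for k
    proof (rule ccontr)
      assume *: "\<not> ?thesis"
      obtain u where "u \<in> F" using \<open>F \<noteq> {}\<close> by auto
      then have "(v, u) \<notin> ?M k"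
        using * insert.hyps(2) by (intro isolated_not_linked) auto
      then show False using conn that \<open>u \<in> F\<close> by auto
    qed
    have "card F \<ge> 2"
    proof -
      obtain u w where "u \<in> F" "w \<in> F" "c v u = 1" "c v w = 2" using v_edge[of 1] v_edge[of 2] by auto
      then have "{u, w} \<subseteq> F" "card {u, w} = 2" by (auto simp: card_insert_if)
      then show ?thesis using insert.hyps(1) by (metis card_mono)
    qed
    then obtain k x y where k: "k \<in> {1, 2, 3}" and xy: "x \<in> F" "y \<in> F" "(x, y) \<notin> ?L k"
      using insert.IH[OF gF] by blast
    obtain i j where ij: "{1, 2, 3} = {i, j, k}" "i \<noteq> j" "i \<noteq> k" "j \<noteq> k"
      using other_colors[OF k] .
    text \<open>Otherwise the component of \<open>z\<close> in \<open>F\<close> would remain one after adding \<open>v\<close>.\<close>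
    have reach: "\<exists>z'\<in>F. (z, z') \<in> ?L k \<and> c v z' = k" if z: "z \<in> F" for z
    proof (rule ccontr)
      assume *: "\<not> ?thesis"
      have "p \<in> F \<and> (z, p) \<in> ?L k" if "(z, p) \<in> ?M k" for p
        using that
      proof (induction rule: rtrancl_induct)
        case base
        then show ?case using z by simp
      next
        case (step p q)
        have "q \<noteq> v"
          using step * gallai3_sym[OF g, of v p] by (auto simp: link_def)
        then have "(p, q) \<in> link F c k" using step by (auto simp: link_def)
        then show ?case using step.IH by (auto simp: link_def intro: rtrancl_into_rtrancl)
      qed
      then show False using conn[OF k, of z v] z insert.hyps(2) by auto
    qed
    \<comment> \<open>Take a \<open>k\<close>-neighbour \<open>z'\<close> of \<open>v\<close> in the
      component of \<open>z\<close>. The edge \<open>u z'\<close> cannot have colour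
      \<open>k\<close>, so it repeats the colour of \<open>v u\<close>.\<close>
    have forced: "c u z = l" if "l \<noteq> k" "u \<in> F" "c v u = l" "z \<in> F" "(u, z) \<notin> ?L k" for l u z
    proof -
      obtain z' where z': "z' \<in> F" "(z, z') \<in> ?L k" "c v z' = k" using reach[OF \<open>z \<in> F\<close>] by blast
      have "(u, z') \<notin> ?L k" using that(5) z'(2) link_rtrancl_sym[OF gF] by (meson rtrancl_trans)
      from not_linked_color[OF \<open>u \<in> F\<close> z'(1) this]
      have "u \<noteq> z'" "c u z' \<noteq> k" by auto
      moreover have "v \<noteq> u" "v \<noteq> z'" using that(2) z'(1) insert.hyps(2) by auto
      ultimately have "c u z' = l"
        using gallai3_triangle[OF g, of v u z'] z'(1,3) that(1-3) by auto
      then show ?thesis using color_to_component_const[OF gF that(2,4) z'(2) that(5)] by simp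
    qed
    have "i \<in> {1, 2, 3}" "j \<in> {1, 2, 3}" using ij(1) by auto
    then obtain u w where u: "u \<in> F" "c v u = i" and w: "w \<in> F" "c v w = j"
      using v_edge by blast
    show False
    proof (cases "(u, w) \<in> ?L k")
      case False
      then have "(w, u) \<notin> ?L k" using link_rtrancl_sym[OF gF] by blast
      then have "c u w = i" "c w u = j" using forced False u w ij by auto
      then show False using gallai3_sym[OF g] ij(2) by auto
    next
      case True
      \<comment> \<open>The unlinked vertices \<open>x\<close> and \<open>y\<close> cannot both lie
        in the component of \<open>u\<close>.\<close>
      obtain z where z: "z \<in> F" "(u, z) \<notin> ?L k"
        using xy link_rtrancl_sym[OF gF] by (meson rtrancl_trans)
      then have zu: "(w, z) \<notin> ?L k" "(z, u) \<notin> ?L k"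
        using True link_rtrancl_sym[OF gF] by (meson rtrancl_trans)+
      have "c u z = i" "c w z = j" using forced z zu u w ij by auto
      then show False
        using color_to_component_const[OF gF z(1) u(1) True zu(2)] gallai3_sym[OF g] ij(2) by auto
    qed
  qed
qed

section \<open>The upper bound\<close>

text \<open>The 7 is meant for 19 vertices: \<open>x\<close> and \<open>y\<close> lie outside the
  union, so at most 17 - 7 = 10 pages remain, one too few.\<close>

definition no_book :: "'a set \<Rightarrow> ('a \<Rightarrow> 'a \<Rightarrow> nat) \<Rightarrow> bool" where
  "no_book V c \<longleftrightarrow> (\<forall>k\<in>{1, 2, 3}. \<forall>x\<in>V. \<forall>y\<in>V. x \<noteq> y \<longrightarrow> c x y \<noteq> k \<longrightarrow>
    card (nbrs V c k x \<union> nbrs V c k y) \<ge> 7)"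

lemma no_bookD:
  "no_book V c \<Longrightarrow> k \<in> {1, 2, 3} \<Longrightarrow> x \<in> V \<Longrightarrow> y \<in> V \<Longrightarrow> x \<noteq> y \<Longrightarrow> c x y \<noteq> k \<Longrightarrow>
    7 \<le> card (nbrs V c k x \<union> nbrs V c k y)"
  unfolding no_book_def by blast

lemma finite_nbrs: "finite V \<Longrightarrow> finite (nbrs V c k x)"
  by (simp add: nbrs_def)

text \<open>The bound 6 for R(3,3), by pigeonhole: three edges at \<open>v\<close> share a colour,
  and their far ends span an edge of that colour or a triangle in the other.\<close>

lemma mono_triangle:
  fixes c :: "'a \<Rightarrow> 'a \<Rightarrow> nat"
  assumes A: "finite A" "card A \<ge> 6" and ij: "\<And>x y. x \<in> A \<Longrightarrow> y \<in> A \<Longrightarrow> x \<noteq> y \<Longrightarrow> c x y \<in> {i, j}"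
  obtains x y z where "{x, y, z} \<subseteq> A" "x \<noteq> y" "x \<noteq> z" "y \<noteq> z" "c x y = c x z" "c x y = c y z"
proof -
  obtain v where v: "v \<in> A" using A by fastforce
  have "A - {v} = nbrs A c i v \<union> nbrs A c j v" using ij[OF v] by (auto simp: nbrs_def)
  moreover have "card (A - {v}) \<ge> 5" using A v by simp
  ultimately have "card (nbrs A c i v) + card (nbrs A c j v) \<ge> 5"
    using card_Un_le[of "nbrs A c i v" "nbrs A c j v"] by simp
  then have "\<exists>l\<in>{i, j}. card (nbrs A c l v) \<ge> 3" by auto
  then obtain l T where l: "l \<in> {i, j}" and "T \<subseteq> nbrs A c l v" "card T = 3"
    by (meson obtain_subset_with_card_n)
  then obtain p q r where pqr: "{p, q, r} \<subseteq> nbrs A c l v" "p \<noteq> q" "p \<noteq> r" "q \<noteq> r"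
    by (auto simp: card_3_iff)
  obtain l' where l': "{i, j} = {l, l'}" using l by auto
  have in_A: "p \<in> A" "q \<in> A" "r \<in> A" "v \<noteq> p" "v \<noteq> q" "v \<noteq> r" "c v p = l" "c v q = l" "c v r = l"
    using pqr by (auto simp: nbrs_def)
  have cols: "c p q \<in> {l, l'}" "c p r \<in> {l, l'}" "c q r \<in> {l, l'}"
    using ij in_A pqr l' by auto
  show ?thesis
  proof (cases "c p q = l \<or> c p r = l \<or> c q r = l")
    case True
    then obtain s t where "{s, t} \<subseteq> {p, q, r}" "s \<noteq> t" "c s t = l"
      using pqr(2-4) by blast
    moreover from this(1) have "{s, t} \<subseteq> A" "v \<noteq> s" "v \<noteq> t" "c v s = l" "c v t = l"
      using in_A by auto
    ultimately show ?thesis using that[of v s t] v by simp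
  next
    case False
    then have "c p q = l'" "c p r = l'" "c q r = l'" using cols by auto
    then show ?thesis using that[of p q r] in_A(1-3) pqr(2-4) by simp
  qed
qed

lemma color_degrees:
  assumes g: "gallai3 V c" and x: "x \<in> V" and ijk: "{1, 2, 3} = {i, j, k}" "i \<noteq> j" "i \<noteq> k" "j \<noteq> k"
  shows "card (nbrs V c i x) + card (nbrs V c j x) + card (nbrs V c k x) = card V - 1"
proof -
  have fin: "finite V" by (rule gallai3_finite[OF g])
  have "V - {x} = nbrs V c i x \<union> nbrs V c j x \<union> nbrs V c k x"
    using gallai3_range[OF g x] unfolding ijk(1) by (auto simp: nbrs_def)
  moreover have "card (nbrs V c i x \<union> nbrs V c j x \<union> nbrs V c k x)
      = card (nbrs V c i x) + card (nbrs V c j x) + card (nbrs V c k x)"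
  proof -
    have "nbrs V c i x \<inter> nbrs V c j x = {}" "(nbrs V c i x \<union> nbrs V c j x) \<inter> nbrs V c k x = {}"
      using ijk(2-4) by (auto simp: nbrs_def)
    then show ?thesis by (simp add: card_Un_disjoint finite_nbrs[OF fin])
  qed
  ultimately show ?thesis using x fin by (metis card_Diff_singleton)
qed

section \<open>Vertex sets split into two sides joined in one colour\<close>

text \<open>The apex \<open>a\<close> contributes nothing in colours other than \<open>k\<close>, so
  every other vertex has degree at least 7 in both of them, leaving at most 18 - 14 = 4 for
  \<open>k\<close>. Off \<open>a\<close>, colour \<open>k\<close> then forms disjoint cliques of
  order 4.\<close>

lemma no_cone:
  assumes g: "gallai3 V c" and nb: "no_book V c" and V: "card V = 19"
    and k: "k \<in> {1, 2, 3}" and a: "a \<in> V" and cone: "\<And>b. b \<in> V - {a} \<Longrightarrow> c a b = k"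
  shows False
proof -
  have fin: "finite V" by (rule gallai3_finite[OF g])
  note [simp] = finite_nbrs[OF fin]
  obtain i j where ij: "{1, 2, 3} = {i, j, k}" "i \<noteq> j" "i \<noteq> k" "j \<noteq> k"
    using other_colors[OF k] .
  have other: "nbrs V c l a = {}" if "l \<noteq> k" for l using cone that by (auto simp: nbrs_def)
  have deg: "card (nbrs V c l b) \<ge> 7" if "l \<in> {i, j}" "b \<in> V - {a}" for l b
    using no_bookD[OF nb, of l a b] other[of l] cone[of b] that ij a by auto
  have a_in: "a \<in> nbrs V c k b" if "b \<in> V - {a}" for b
    using cone[OF that] gallai3_sym[OF g] a that by (auto simp: nbrs_def)
  have le4: "card (nbrs V c k b) \<le> 4" if "b \<in> V - {a}" for b
    using color_degrees[OF g _ ij, of b] deg[of i b] deg[of j b] that V by auto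
  text \<open>Both neighbourhoods have at most 4 elements and share \<open>a\<close>, so the bound 7 is tight.\<close>
  have union: "card (nbrs V c k b) = 4 \<and> nbrs V c k b \<inter> nbrs V c k b' = {a}"
    if b: "b \<in> V - {a}" "b' \<in> V - {a}" "b \<noteq> b'" "c b b' \<noteq> k" for b b'
  proof -
    let ?N = "nbrs V c k b" and ?N' = "nbrs V c k b'"
    have "7 \<le> card (?N \<union> ?N')" using no_bookD[OF nb k, of b b'] b by auto
    moreover have "card (?N \<union> ?N') + card (?N \<inter> ?N') = card ?N + card ?N'"
      by (simp add: card_Un_Int[symmetric])
    moreover have sub: "{a} \<subseteq> ?N \<inter> ?N'" using a_in b by auto
    moreover have "card (?N \<inter> ?N') \<ge> 1" using card_mono[OF _ sub] by simp
    moreover have "card ?N \<le> 4" "card ?N' \<le> 4" using le4 b(1,2) by auto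
    ultimately have "card ?N = 4" "card (?N \<inter> ?N') = card {a}" by auto
    then show ?thesis using card_subset_eq[OF _ sub] by auto
  qed
  \<comment> \<open>Closed neighbourhood in colour \<open>k\<close> without the apex: the blocks of
    the partition.\<close>
  define R where "R b = insert b (nbrs V c k b - {a})" for b
  have cardR: "card (R b) = 4" if b: "b \<in> V - {a}" for b
  proof -
    \<comment> \<open>An edge of colour \<open>i\<close> at \<open>b\<close> supplies the partner
      that \<open>union\<close> requires.\<close>
    have "nbrs V c i b \<noteq> {}" using deg[of i b] b by auto
    then obtain b' where "b' \<in> nbrs V c i b" by auto
    moreover have "a \<notin> nbrs V c i b" using a_in[OF b] ij by (auto simp: nbrs_def)
    ultimately have "card (nbrs V c k b) = 4" using union[of b b'] b ij by (auto simp: nbrs_def)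
    moreover have "b \<notin> nbrs V c k b" by (simp add: nbrs_def)
    ultimately show ?thesis using a_in[OF b] by (simp add: R_def)
  qed
  have sub: "R b \<subseteq> R b'" if b: "b \<in> V - {a}" "b' \<in> V - {a}" "b \<noteq> b'" "c b b' = k" for b b'
  proof
    fix z assume z: "z \<in> R b"
    show "z \<in> R b'"
    proof (cases "z = b \<or> z = b'")
      case True
      then show ?thesis using b gallai3_sym[OF g] by (auto simp: R_def nbrs_def)
    next
      case False
      then have zb: "z \<in> V - {a}" "c b z = k" using z by (auto simp: R_def nbrs_def)
      \<comment> \<open>If \<open>z b'\<close> were not of colour \<open>k\<close>, then
        \<open>b\<close> would be a common neighbour besides \<open>a\<close>, against
        \<open>union\<close>.\<close>
      have "b \<in> nbrs V c k z \<inter> nbrs V c k b'"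
        using zb b False gallai3_sym[OF g] by (auto simp: nbrs_def)
      then have "c z b' = k" using union[of z b'] zb b False by auto
      then show ?thesis using zb False gallai3_sym[OF g] by (auto simp: R_def nbrs_def)
    qed
  qed
  have disj: "R b = R b' \<or> R b \<inter> R b' = {}" if b: "b \<in> V - {a}" "b' \<in> V - {a}" for b b'
  proof (cases "b = b' \<or> c b b' = k")
    case True
    then show ?thesis using sub b gallai3_sym[OF g] by (metis subset_antisym)
  next
    case False
    then have "nbrs V c k b \<inter> nbrs V c k b' = {a}" using union b by auto
    then show ?thesis using False gallai3_sym[OF g, of b b'] by (auto simp: R_def nbrs_def)
  qed
  have Un: "\<Union> (R ` (V - {a})) = V - {a}" by (auto simp: R_def nbrs_def)
  have "4 * card (R ` (V - {a})) = card (\<Union> (R ` (V - {a})))"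
  proof (rule card_partition)
    show "finite (R ` (V - {a}))" "finite (\<Union> (R ` (V - {a})))" unfolding Un using fin by simp_all
    show "card S = 4" if "S \<in> R ` (V - {a})" for S using that cardR by blast
    show "S \<inter> T = {}" if "S \<in> R ` (V - {a})" "T \<in> R ` (V - {a})" "S \<noteq> T" for S T
      using that disj by blast
  qed
  then have "4 * card (R ` (V - {a})) = 18" unfolding Un using V a fin by simp
  then show False by presburger
qed

text \<open>If \<open>A\<close> is not a singleton, the bound 7 is tight: all further vertices of
  \<open>A\<close> meet \<open>x\<close> or \<open>y\<close> in each colour other than
  \<open>k\<close> and \<open>c x y\<close>. This excludes colour \<open>k\<close> inside
  \<open>A\<close>, and then monochromatic triangles.\<close>

lemma no_small_split:
  assumes g: "gallai3 V c" and nb: "no_book V c" and V: "card V = 19"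
    and k: "k \<in> {1, 2, 3}" and AB: "A \<union> B = V" "A \<inter> B = {}" "A \<noteq> {}" "card A \<le> 9"
    and mono: "\<And>a b. a \<in> A \<Longrightarrow> b \<in> B \<Longrightarrow> c a b = k"
  shows False
proof (cases "card A = 1")
  case True
  then obtain a where "A = {a}" by (auto simp: card_1_singleton_iff)
  then show False using no_cone[OF g nb V k, of a] AB mono by auto
next
  case False
  have fin: "finite A" using gallai3_finite[OF g] AB by auto
  text \<open>A vertex of \<open>B\<close> is never an \<open>l\<close>-neighbour of \<open>x\<close> or \<open>y\<close>, so 7 vertices of \<open>A\<close> other than \<open>x\<close>, \<open>y\<close> are.\<close>
  have cover: "nbrs V c l x \<union> nbrs V c l y = A - {x, y} \<and> card A = 9"
    if xy: "x \<in> A" "y \<in> A" "x \<noteq> y" and l: "l \<in> {1, 2, 3}" "l \<noteq> k" "l \<noteq> c x y" for x y l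
  proof -
    have sub: "nbrs V c l x \<union> nbrs V c l y \<subseteq> A - {x, y}"
      using mono xy l gallai3_sym[OF g, of x y] AB(1) by (auto simp: nbrs_def)
    moreover have "7 \<le> card (nbrs V c l x \<union> nbrs V c l y)"
      using no_bookD[OF nb l(1), of x y] xy l AB(1) by auto
    moreover have "card (A - {x, y}) = card A - 2" using xy fin by (simp add: card_Diff_subset)
    ultimately have "card (nbrs V c l x \<union> nbrs V c l y) = card (A - {x, y})" "card A = 9"
      using AB(4) card_mono[OF _ sub] fin by auto
    then show ?thesis using card_subset_eq[OF _ sub] fin by auto
  qed
  obtain i j where ij: "{1, 2, 3} = {i, j, k}" "i \<noteq> j" "i \<noteq> k" "j \<noteq> k"
    using other_colors[OF k] .
  have ij_in: "i \<in> {1, 2, 3}" "j \<in> {1, 2, 3}" using ij(1) by auto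
  have "card A \<noteq> 0" using fin AB(3) by simp
  then have "card A \<ge> 2" using False by simp
  then obtain x y where "x \<in> A" "y \<in> A" "x \<noteq> y"
    by (metis One_nat_def card_le_Suc0_iff_eq fin not_less_eq_eq numeral_2_eq_2)
  \<comment> \<open>At least one of \<open>i\<close> and \<open>j\<close> differs from
    \<open>c x y\<close>.\<close>
  then have card9: "card A = 9"
    using cover[of x y i] cover[of x y j] ij_in ij by metis
  have colA: "c x y \<in> {i, j}" if xy: "x \<in> A" "y \<in> A" "x \<noteq> y" for x y
  proof (rule ccontr)
    assume "c x y \<notin> {i, j}"
    then have ck: "c x y = k" using gallai3_range[OF g, of x y] xy AB(1) unfolding ij(1) by auto
    have "A - {x, y} \<noteq> {}"
    proof
      assume "A - {x, y} = {}"
      then have "card A \<le> card {x, y}" by (intro card_mono) auto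
      then show False using card9 xy by simp
    qed
    then obtain z where z: "z \<in> A - {x, y}" by auto
    \<comment> \<open>Both \<open>i\<close> and \<open>j\<close> join \<open>z\<close> to a pair of
      colour \<open>k\<close>, which gives a rainbow triangle.\<close>
    have "z \<in> nbrs V c i x \<union> nbrs V c i y" "z \<in> nbrs V c j x \<union> nbrs V c j y"
      using cover[OF xy, of i] cover[OF xy, of j] z ij ij_in ck by auto
    then show False using gallai3_triangle[OF g, of x y z] xy z AB(1) ck ij by (auto simp: nbrs_def)
  qed
  obtain x y z where t: "{x, y, z} \<subseteq> A" "x \<noteq> y" "x \<noteq> z" "y \<noteq> z" "c x y = c x z" "c x y = c y z"
    using mono_triangle[of A c i j] fin card9 colA by auto
  obtain l where l: "l \<in> {i, j}" "l \<noteq> c x y" using ij(2) by auto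
  then have "l \<in> {1, 2, 3}" "l \<noteq> k" using ij ij_in by blast+
  then have "z \<in> nbrs V c l x \<union> nbrs V c l y" using cover[of x y l] t(1-4) l(2) by auto
  then show False using t(5,6) l(2) by (auto simp: nbrs_def)
qed

lemma no_split:
  assumes g: "gallai3 V c" and nb: "no_book V c" and V: "card V = 19"
    and AB: "A \<union> B = V" "A \<inter> B = {}" "A \<noteq> {}" "B \<noteq> {}"
    and mono: "\<And>a b. a \<in> A \<Longrightarrow> b \<in> B \<Longrightarrow> c a b = k"
  shows False
proof -
  obtain a b where ab: "a \<in> A" "b \<in> B" using AB by blast
  then have "a \<in> V" "b \<in> V" "a \<noteq> b" using AB by auto
  then have k: "k \<in> {1, 2, 3}" using gallai3_range[OF g] mono[OF ab] by metis
  have mono': "c b a = k" if "b \<in> B" "a \<in> A" for a b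
    using mono[OF that(2,1)] gallai3_sym[OF g, of b a] by simp
  have "card A + card B = 19"
    using AB V gallai3_finite[OF g] by (metis card_Un_disjoint finite_Un)
  then consider "card A \<le> 9" | "card B \<le> 9" by linarith
  then show False
  proof cases
    case 1
    then show False using no_small_split[OF g nb V k AB(1-3)] mono by blast
  next
    case 2
    have "B \<union> A = V" "B \<inter> A = {}" using AB by auto
    then show False using no_small_split[OF g nb V k _ _ AB(4) 2] mono' by blast
  qed
qed

section \<open>Components of the disconnected colour on 19 vertices\<close>

lemma book_exists:
  assumes g: "gallai3 V c" and V: "card V = 19"
  shows "\<not> no_book V c"
proof
  assume nb: "no_book V c"
  have fin: "finite V" by (rule gallai3_finite[OF g])
  note [simp] = finite_nbrs[OF fin]
  obtain k x1 x2 where k: "k \<in> {1, 2, 3}" and x1: "x1 \<in> V" and x2: "x2 \<in> V"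
    and x12: "(x1, x2) \<notin> (link V c k)\<^sup>*"
    using disconnected_color[OF fin g] V by auto
  obtain i j where ij: "{1, 2, 3} = {i, j, k}" "i \<noteq> j" "i \<noteq> k" "j \<noteq> k"
    using other_colors[OF k] .
  define C where "C x = {z. (x, z) \<in> (link V c k)\<^sup>*}" for x
  have CV: "C x \<subseteq> V" if "x \<in> V" for x using that link_rtrancl_in by (fastforce simp: C_def)
  have C_self: "x \<in> C x" for x by (simp add: C_def)
  have finC: "finite (C x)" if "x \<in> V" for x using CV[OF that] fin finite_subset by blast
  have C_disj: "C x \<inter> C y = {}" if "y \<notin> C x" for x y
    using that link_rtrancl_sym[OF g] unfolding C_def
    by (metis (no_types, lifting) disjoint_iff mem_Collect_eq rtrancl_trans)
  have C_sym: "x \<notin> C y" if "y \<notin> C x" for x y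
    using that link_rtrancl_sym[OF g] unfolding C_def by blast
  \<comment> \<open>Constancy towards a component is applied once on each side.\<close>
  have C_mono: "c p q = c x y" if "x \<in> V" "y \<in> V" "y \<notin> C x" "p \<in> C x" "q \<in> C y" for x y p q
  proof -
    have pq: "(x, p) \<in> (link V c k)\<^sup>*" "(y, q) \<in> (link V c k)\<^sup>*" "(x, y) \<notin> (link V c k)\<^sup>*"
      using that by (auto simp: C_def)
    have "p \<in> V" using CV that by blast
    have "(y, x) \<notin> (link V c k)\<^sup>*" "(p, y) \<notin> (link V c k)\<^sup>*"
      using pq link_rtrancl_sym[OF g] by (meson rtrancl_trans)+
    then have "c y p = c y x" "c p q = c p y"
      using color_to_component_const[OF g] pq that \<open>p \<in> V\<close> by blast+
    then show ?thesis using gallai3_sym[OF g] by metis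
  qed
  have nbrs_C: "nbrs V c k x \<subseteq> C x - {x}" if "x \<in> V" for x
    using that by (auto simp: nbrs_def C_def link_def)
  \<comment> \<open>The \<open>k\<close>-neighbours of a vertex stay in its component and omit the
    vertex itself, so 7 is at most the sum of both orders minus 2.\<close>
  have card_pair: "card (C x) + card (C y) \<ge> 9" if xy: "x \<in> V" "y \<in> V" "y \<notin> C x" for x y
  proof -
    have "x \<noteq> y" "c x y \<noteq> k" using not_linked_color[of x V y c k] xy by (auto simp: C_def)
    then have "7 \<le> card (nbrs V c k x \<union> nbrs V c k y)" using no_bookD[OF nb k] xy by auto
    also have "\<dots> \<le> card (nbrs V c k x) + card (nbrs V c k y)" by (rule card_Un_le)
    also have "card (nbrs V c k x) \<le> card (C x) - 1"
      using card_mono[OF _ nbrs_C, of x] xy finC C_self by simp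
    also have "card (nbrs V c k y) \<le> card (C y) - 1"
      using card_mono[OF _ nbrs_C, of y] xy finC C_self by simp
    finally have "7 \<le> card (C x) - 1 + (card (C y) - 1)" by simp
    moreover have "card (C x) > 0" "card (C y) > 0"
      using finC xy C_self by (auto simp: card_gt_0_iff)
    ultimately show ?thesis by linarith
  qed
  have x2': "x2 \<notin> C x1" using x12 by (simp add: C_def)
  have "C x1 \<union> C x2 \<noteq> V"
    using no_split[OF g nb V, of "C x1" "C x2" "c x1 x2"] C_disj[OF x2'] C_self
      C_mono[OF x1 x2 x2'] by blast
  then obtain x3 where x3: "x3 \<in> V" "x3 \<notin> C x1" "x3 \<notin> C x2" using CV x1 x2 by blast
  have x123: "C x1 \<union> C x2 \<union> C x3 \<noteq> V"
  proof
    assume U: "C x1 \<union> C x2 \<union> C x3 = V"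
    have split: False
      if "{y1, y2, y3} \<subseteq> V" "C y1 \<union> C y2 \<union> C y3 = V" "y2 \<notin> C y1" "y3 \<notin> C y1" "c y1 y2 = c y1 y3"
      for y1 y2 y3
    proof (rule no_split[OF g nb V, of "C y1" "C y2 \<union> C y3" "c y1 y2"])
      show "c a b = c y1 y2" if "a \<in> C y1" "b \<in> C y2 \<union> C y3" for a b
        using C_mono[of y1 y2 a b] C_mono[of y1 y3 a b] that \<open>{y1, y2, y3} \<subseteq> V\<close>
          \<open>y2 \<notin> C y1\<close> \<open>y3 \<notin> C y1\<close> \<open>c y1 y2 = c y1 y3\<close> by auto
    qed (use that C_disj C_self in blast)+
    \<comment> \<open>The representatives span no rainbow triangle, so one component is joined to
      the two others in one colour.\<close>
    have "x1 \<noteq> x2" "x1 \<noteq> x3" "x2 \<noteq> x3" using x2' x3 C_self by blast+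
    then consider "c x1 x2 = c x1 x3" | "c x2 x1 = c x2 x3" | "c x3 x1 = c x3 x2"
      using gallai3_triangle[OF g x1 x2 x3(1)] gallai3_sym[OF g, of x1] gallai3_sym[OF g, of x2 x3]
      by metis
    then show False
    proof cases
      case 1
      then show False using split[of x1 x2 x3] U x1 x2 x2' x3 by simp
    next
      case 2
      have "C x2 \<union> C x1 \<union> C x3 = V" using U by blast
      then show False using 2 split[of x2 x1 x3] x1 x2 C_sym[OF x2'] x3 by simp
    next
      case 3
      have "C x3 \<union> C x1 \<union> C x2 = V" using U by blast
      then show False using 3 split[of x3 x1 x2] x1 x2 C_sym[OF x3(2)] C_sym[OF x3(3)] x3 by simp
    qed
  qed
  then obtain x4 where x4: "x4 \<in> V" "x4 \<notin> C x1" "x4 \<notin> C x2" "x4 \<notin> C x3"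
    using CV x1 x2 x3 by blast
  let ?U = "C x1 \<union> C x2 \<union> C x3 \<union> C x4"
  have UV: "?U \<subseteq> V" using CV x1 x2 x3 x4 by blast
  have cardU: "card ?U = card (C x1) + card (C x2) + card (C x3) + card (C x4)"
    using finC[OF x1] finC[OF x2] finC[OF x3(1)] finC[OF x4(1)] C_disj[OF x2'] C_disj[OF x3(2)]
      C_disj[OF x3(3)] C_disj[OF x4(2)] C_disj[OF x4(3)] C_disj[OF x4(4)]
    by (simp add: card_Un_disjoint Int_Un_distrib2)
  then have sum_le: "card (C x1) + card (C x2) + card (C x3) + card (C x4) \<le> 19"
    using card_mono[OF fin UV] V by simp
  note pairs = card_pair[OF x1 x2 x2'] card_pair[OF x1 x3(1,2)] card_pair[OF x2 x3(1,3)]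
    card_pair[OF x1 x4(1,2)] card_pair[OF x2 x4(1,3)] card_pair[OF x3(1) x4(1,4)]
  \<comment> \<open>Adding the pair bounds of the other three components gives them at least 27/2,
    hence 14, of at most 19 vertices.\<close>
  have le5: "card (C x1) \<le> 5" "card (C x2) \<le> 5" "card (C x3) \<le> 5" "card (C x4) \<le> 5"
    using sum_le pairs by linarith+
  \<comment> \<open>A fifth component would leave at most 19 - 9 - 9 = 1 vertex for
    \<open>C x4\<close>, contradicting \<open>card_pair\<close> and \<open>le5\<close>.\<close>
  have U: "?U = V"
  proof (rule ccontr)
    assume "?U \<noteq> V"
    then obtain x5 where x5: "x5 \<in> V" "x5 \<notin> ?U" using UV by blast
    have "?U \<union> C x5 \<subseteq> V" using CV UV x5 by blast
    then have "card (?U \<union> C x5) \<le> 19" using card_mono[OF fin] V by metis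
    moreover have "?U \<inter> C x5 = {}" using C_disj[of x5] x5 by auto
    ultimately have "card ?U + card (C x5) \<le> 19"
      using finC x1 x2 x3 x4 x5 by (simp add: card_Un_disjoint)
    moreover have "card (C x1) + card (C x5) \<ge> 9" using card_pair x1 x5 by auto
    ultimately show False using cardU pairs le5 by linarith
  qed
  \<comment> \<open>The edge from \<open>x1\<close> to this \<open>y\<close>, of colour
    \<open>k\<close>, is the spine for the final contradiction.\<close>
  have "\<exists>y. y \<in> nbrs V c k x1"
  proof (rule ccontr)
    assume "\<not> ?thesis"
    then have "nbrs V c k x1 = {}" by auto
    moreover have "x1 \<noteq> x2" "c x1 x2 \<noteq> k" using not_linked_color[OF x1 x2 x12] by auto
    then have "7 \<le> card (nbrs V c k x1 \<union> nbrs V c k x2)" using no_bookD[OF nb k x1 x2] by auto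
    moreover have "card (nbrs V c k x2) \<le> card (C x2)"
      using nbrs_C[OF x2] finC[OF x2] by (intro card_mono) auto
    ultimately show False using le5 by simp
  qed
  then obtain y where y: "y \<in> V" "x1 \<noteq> y" "c x1 y = k" by (auto simp: nbrs_def)
  then have yC: "y \<in> C x1" using x1 by (auto simp: C_def link_def)
  have to: "c p q = c x1 w" if "p \<in> {x1, y}" "w \<in> {x2, x3, x4}" "q \<in> C w" for p q w
    using C_mono[of x1 w p q] that yC C_self x1 x2 x2' x3 x4 by auto
  have not_k: "c x1 w \<in> {i, j}" if "w \<in> {x2, x3, x4}" for w
  proof -
    have "w \<in> V" "w \<notin> C x1" using that x2 x2' x3 x4 by auto
    then show ?thesis
      using not_linked_color[of x1 V w c k] gallai3_range[OF g x1, of w] x1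
      unfolding ij(1) C_def by auto
  qed
  \<comment> \<open>Otherwise all four components would have order 5, making 20 vertices.\<close>
  have "\<exists>w\<in>{x2, x3, x4}. card (C w) + card (C x1) \<le> 9"
    using sum_le le5 by auto
  then obtain w where w: "w \<in> {x2, x3, x4}" "card (C w) + card (C x1) \<le> 9" ..
  have w': "w \<in> V" "w \<notin> C x1" using w x2 x2' x3 x4 by auto
  \<comment> \<open>With spine \<open>p w\<close>, the component of \<open>w\<close> gives too few
    \<open>k\<close>-neighbours unless \<open>p\<close> is joined in colour \<open>k\<close> to all
    of its own component.\<close>
  have clique: "c p q = k" if p: "p \<in> C x1" and q: "q \<in> C x1" "q \<noteq> p" for p q
  proof -
    have pV: "p \<in> V" using p CV x1 by blast
    have Cp: "C p = C x1"
      using p link_rtrancl_sym[OF g] unfolding C_def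
      by (metis (no_types, lifting) mem_Collect_eq rtrancl_trans)
    have "p \<noteq> w" "c p w \<noteq> k"
      using not_linked_color[of p V w c k] w' pV Cp by (auto simp: C_def)
    then have "7 \<le> card (nbrs V c k p \<union> nbrs V c k w)"
      using no_bookD[OF nb k pV w'(1)] by auto
    also have "\<dots> \<le> card (nbrs V c k p) + card (nbrs V c k w)" by (rule card_Un_le)
    also have "card (nbrs V c k w) \<le> card (C w) - 1"
      using card_mono[OF _ nbrs_C[OF w'(1)]] w' finC C_self by simp
    finally have "7 \<le> card (nbrs V c k p) + (card (C w) - 1)" by simp
    moreover have "card (C w) > 0" using finC[OF w'(1)] C_self by (auto simp: card_gt_0_iff)
    ultimately have "card (C x1) - 1 \<le> card (nbrs V c k p)" using w(2) by linarith
    moreover have "card (C x1 - {p}) = card (C x1) - 1" using p by simp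
    ultimately have "nbrs V c k p = C x1 - {p}"
      using card_seteq[of "C x1 - {p}"] nbrs_C[OF pV] finC[OF x1] Cp by auto
    then show ?thesis using q by (auto simp: nbrs_def)
  qed
  have cols: "c x1 x2 \<in> {i, j}" "c x1 x3 \<in> {i, j}" "c x1 x4 \<in> {i, j}" using not_k by auto
  \<comment> \<open>Three colours from \<open>{i, j}\<close>: two coincide, and the other value
    \<open>l\<close> leads from \<open>C x1\<close> to at most one component, that of
    \<open>u\<close>.\<close>
  obtain l u where l: "l \<in> {i, j}" and u: "u \<in> {x2, x3, x4}"
    and rare: "\<And>v. v \<in> {x2, x3, x4} \<Longrightarrow> v \<noteq> u \<Longrightarrow> c x1 v \<noteq> l"
  proof -
    consider "c x1 x2 = c x1 x3" | "c x1 x2 = c x1 x4" | "c x1 x3 = c x1 x4" using cols by fastforce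
    then obtain u l' where "u \<in> {x2, x3, x4}" "\<And>v. v \<in> {x2, x3, x4} \<Longrightarrow> v \<noteq> u \<Longrightarrow> c x1 v = l'"
      by cases (blast intro: that)+
    moreover obtain l where "l \<in> {i, j}" "l \<noteq> l'" using ij(2) by auto
    ultimately show thesis using that by metis
  qed
  have "nbrs V c l x1 \<union> nbrs V c l y \<subseteq> C u"
  proof
    fix q assume "q \<in> nbrs V c l x1 \<union> nbrs V c l y"
    then obtain p where p: "p \<in> {x1, y}" "q \<in> V" "q \<noteq> p" "c p q = l" by (auto simp: nbrs_def)
    have "q \<notin> C x1" using clique[of p q] p yC C_self l ij by auto
    then obtain v where v: "v \<in> {x2, x3, x4}" "q \<in> C v" using p(2) U by blast
    then have "c x1 v = l" using to[OF p(1), of v q] p by auto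
    then show "q \<in> C u" using rare v by auto
  qed
  then have "card (nbrs V c l x1 \<union> nbrs V c l y) \<le> card (C u)"
    using finC u x2 x3 x4 by (intro card_mono) auto
  also have "\<dots> \<le> 5" using u le5 by auto
  finally show False
    using no_bookD[OF nb, of l x1 y] x1 y l ij by auto
qed

section \<open>Books as subgraphs\<close>

lemma verts_book: "verts (book n) = {Inl 0, Inl 1} \<union> (\<lambda>i. Inr (i, 0)) ` {..<n}"
  by (auto simp: book_def graph_join_def complete_graph_def copies_def)

lemma edges_book:
  "edges (book n) = {{Inl 0, Inl 1}} \<union> (\<lambda>i. {Inl 0, Inr (i, 0)}) ` {..<n}
     \<union> (\<lambda>i. {Inl 1, Inr (i, 0)}) ` {..<n}"
proof -
  have K2: "edges (complete_graph 2) = {{0, 1}}"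
  proof -
    have "e = {0, 1}" if "e \<subseteq> {..<2}" "card e = 2" for e :: "nat set"
    proof -
      have "e = {..<2}" using that by (intro card_seteq) auto
      then show ?thesis by auto
    qed
    then show ?thesis by (auto simp: complete_graph_def)
  qed
  have "edges (complete_graph 1) = {}"
    by (auto simp: complete_graph_def card_2_iff)
  then have copies: "edges (copies n (complete_graph 1)) = {}" by (simp add: copies_def)
  have v: "verts (complete_graph 2) = {0, 1}" "verts (copies n (complete_graph 1)) = {..<n} \<times> {0}"
    by (auto simp: complete_graph_def copies_def)
  show ?thesis
    unfolding book_def graph_join_def graph.select_convs K2 copies v by auto
qed

lemma isomorphic_book:
  assumes "finite Z" "x \<noteq> y" "x \<notin> Z" "y \<notin> Z"
  shows "isomorphic \<lparr>verts = {x, y} \<union> Z,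
    edges = {{x, y}} \<union> (\<lambda>z. {x, z}) ` Z \<union> (\<lambda>z. {y, z}) ` Z\<rparr> (book (card Z))"
proof -
  obtain h where h: "bij_betw h Z {..<card Z}"
    using ex_bij_betw_finite_nat[OF assms(1)] by (auto simp: atLeast0LessThan)
  then have inj: "inj_on h Z" and im: "h ` Z = {..<card Z}" by (auto simp: bij_betw_def)
  define \<phi> :: "'a \<Rightarrow> nat + nat \<times> nat" where
    "\<phi> v = (if v = x then Inl 0 else if v = y then Inl 1 else Inr (h v, 0))" for v
  have \<phi>: "\<phi> x = Inl 0" "\<phi> y = Inl 1" "\<And>z. z \<in> Z \<Longrightarrow> \<phi> z = Inr (h z, 0)"
    using assms by (auto simp: \<phi>_def)
  have img: "\<phi> ` ({x, y} \<union> Z) = verts (book (card Z))"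
    unfolding verts_book im[symmetric] by (auto simp: \<phi> image_iff)
  have injp: "inj_on \<phi> ({x, y} \<union> Z)"
    using inj assms by (auto simp: inj_on_def \<phi>)
  let ?E = "{{x, y}} \<union> (\<lambda>z. {x, z}) ` Z \<union> (\<lambda>z. {y, z}) ` Z"
  have E: "edges (book (card Z)) = (`) \<phi> ` ?E"
    unfolding edges_book im[symmetric] by (simp add: \<phi> image_Un image_image)
  have "{u, v} \<in> ?E \<longleftrightarrow> {\<phi> u, \<phi> v} \<in> edges (book (card Z))"
    if "u \<in> {x, y} \<union> Z" "v \<in> {x, y} \<union> Z" for u v
  proof -
    \<comment> \<open>Taking images of vertex sets under the injective \<open>\<phi>\<close> is
      injective, so edges are reflected as well as preserved.\<close>
    have "?E \<subseteq> Pow ({x, y} \<union> Z)" by auto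
    moreover have "{u, v} \<in> Pow ({x, y} \<union> Z)" using that by auto
    ultimately have "\<phi> ` {u, v} \<in> (`) \<phi> ` ?E \<longleftrightarrow> {u, v} \<in> ?E"
      using inj_on_image_mem_iff[OF inj_on_image_Pow[OF injp]] by metis
    then show ?thesis unfolding E by simp
  qed
  then show ?thesis unfolding isomorphic_def using img injp by (auto simp: bij_betw_def)
qed

text \<open>The spine and the pages are pulled back along the inverse isomorphism.\<close>

lemma isomorphic_bookE:
  assumes "isomorphic H (book n)"
  obtains x y Z where "x \<noteq> y" "x \<notin> Z" "y \<notin> Z" "{x, y} \<union> Z \<subseteq> verts H" "card Z = n"
    "{x, y} \<in> edges H" "\<And>z. z \<in> Z \<Longrightarrow> {x, z} \<in> edges H \<and> {y, z} \<in> edges H"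
proof -
  obtain \<phi> where bij: "bij_betw \<phi> (verts H) (verts (book n))"
    and E: "\<And>u v. u \<in> verts H \<Longrightarrow> v \<in> verts H \<Longrightarrow>
      {u, v} \<in> edges H \<longleftrightarrow> {\<phi> u, \<phi> v} \<in> edges (book n)"
    using assms unfolding isomorphic_def by blast
  define \<psi> where "\<psi> = inv_into (verts H) \<phi>"
  have \<psi>: "bij_betw \<psi> (verts (book n)) (verts H)"
    unfolding \<psi>_def by (rule bij_betw_inv_into[OF bij])
  have inj: "inj_on \<psi> (verts (book n))" using \<psi> by (rule bij_betw_imp_inj_on)
  have mem: "\<psi> a \<in> verts H" if "a \<in> verts (book n)" for a using \<psi> that by (auto simp: bij_betw_def)
  have E': "{\<psi> a, \<psi> b} \<in> edges H \<longleftrightarrow> {a, b} \<in> edges (book n)"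
    if "a \<in> verts (book n)" "b \<in> verts (book n)" for a b
    using E[OF mem mem, OF that] bij_betw_inv_into_right[OF bij] that by (simp add: \<psi>_def)
  let ?P = "(\<lambda>i. Inr (i, 0)) ` {..<n} :: (nat + nat \<times> nat) set"
  have V: "Inl 0 \<in> verts (book n)" "Inl 1 \<in> verts (book n)" "?P \<subseteq> verts (book n)"
    by (auto simp: verts_book)
  show ?thesis
  proof (rule that[of "\<psi> (Inl 0)" "\<psi> (Inl 1)" "\<psi> ` ?P"])
    show "\<psi> (Inl 0) \<noteq> \<psi> (Inl 1)" using inj_onD[OF inj _ V(1,2)] by auto
    show "\<psi> (Inl 0) \<notin> \<psi> ` ?P" "\<psi> (Inl 1) \<notin> \<psi> ` ?P"
      using inj_on_image_mem_iff[OF inj V(1,3)] inj_on_image_mem_iff[OF inj V(2,3)] by auto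
    show "{\<psi> (Inl 0), \<psi> (Inl 1)} \<union> \<psi> ` ?P \<subseteq> verts H" using mem V by auto
    show "card (\<psi> ` ?P) = n"
      using inj_on_subset[OF inj V(3)] by (simp add: card_image inj_on_def)
    show "{\<psi> (Inl 0), \<psi> (Inl 1)} \<in> edges H" using E' V by (simp add: edges_book)
    show "{\<psi> (Inl 0), z} \<in> edges H \<and> {\<psi> (Inl 1), z} \<in> edges H" if "z \<in> \<psi> ` ?P" for z
      using that E' V by (auto simp: edges_book)
  qed
qed

section \<open>The lower bound\<close>

text \<open>Vertex \<open>9 b + 3 r + c\<close> is the cell in row \<open>r\<close> and column \<open>c\<close> of the \<open>b\<close>-th board.\<close>

definition rook :: "nat \<Rightarrow> nat \<Rightarrow> nat" where
  "rook x y = (if x div 9 \<noteq> y div 9 then 3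
    else if x div 3 = y div 3 \<or> x mod 3 = y mod 3 then 1 else 2)"

text \<open>A finite check, phrased with lists so that it evaluates. It counts the possible pages of
  a book with spine \<open>x y\<close> avoiding \<open>k\<close>; by symmetry \<open>y < x\<close>
  suffices.\<close>

lemma rook_pages_less:
  "\<forall>x\<in>set [0..<18]. \<forall>y\<in>set [0..<x]. \<forall>k\<in>set [1, 2, 3]. rook x y \<noteq> k \<longrightarrow>
    length (filter (\<lambda>z. z \<noteq> x \<and> z \<noteq> y \<and> rook x z \<noteq> k \<and> rook y z \<noteq> k) [0..<18]) \<le> 10"
  by code_simp

lemma rook_sym: "rook x y = rook y x"
  by (simp only: rook_def eq_commute[of "y div 9" "x div 9"] eq_commute[of "y div 3" "x div 3"]
      eq_commute[of "y mod 3" "x mod 3"])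

lemma rook_pages:
  assumes "x < 18" "y < 18" "x \<noteq> y" "k \<in> {1, 2, 3}" "rook x y \<noteq> k"
  shows "card {z. z < 18 \<and> z \<noteq> x \<and> z \<noteq> y \<and> rook x z \<noteq> k \<and> rook y z \<noteq> k} \<le> 10"
  using assms
proof (induction x y rule: linorder_wlog)
  case (le y x)
  let ?zs = "filter (\<lambda>z. z \<noteq> x \<and> z \<noteq> y \<and> rook x z \<noteq> k \<and> rook y z \<noteq> k) [0..<18]"
  have "x \<in> set [0..<18]" "y \<in> set [0..<x]" "k \<in> set [1, 2, 3]" "rook x y \<noteq> k"
    using le rook_sym[of x y] by auto
  then have "length ?zs \<le> 10" using rook_pages_less by blast
  moreover have "{z. z < 18 \<and> z \<noteq> y \<and> z \<noteq> x \<and> rook y z \<noteq> k \<and> rook x z \<noteq> k} = set ?zs" by auto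
  ultimately show ?case using card_length[of ?zs] by simp
next
  case (sym x y)
  then show ?case using rook_sym[of x y] by (simp add: conj_ac)
qed

text \<open>\<open>Min\<close> and \<open>Max\<close> recover the ends of an edge given as a set;
  symmetry makes their order immaterial.\<close>

lemma rook_Min_Max: "rook (Min {x, y}) (Max {x, y}) = rook x y"
  by (cases "x \<le> y") (auto simp: rook_sym)

lemma gallai_rook:
  "gallai_coloring 3 p (\<lambda>e. rook (Min e) (Max e))"
  unfolding gallai_coloring_def coloring_def rainbow_triangle_def rook_Min_Max
proof (intro conjI notI)
  have "rook x y \<in> {1..3}" for x y by (simp add: rook_def)
  then show "(\<lambda>e. rook (Min e) (Max e)) \<in> edges (complete_graph p) \<rightarrow> {1..3}" by blast
next
  assume "\<exists>x\<in>verts (complete_graph p). \<exists>y\<in>verts (complete_graph p). \<exists>z\<in>verts (complete_graph p).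
    distinct [x, y, z] \<and> distinct [rook x y, rook x z, rook y z]"
  then obtain x y z where d: "rook x y \<noteq> rook x z" "rook x y \<noteq> rook y z" "rook x z \<noteq> rook y z"
    by auto
  have 3: "u div 9 = v div 9 \<or> rook u v = 3" for u v by (simp add: rook_def)
  \<comment> \<open>Two edges between different boards would share colour 3, so at most one edge
    crosses; transitivity then puts all three vertices on one board, where only two colours
    occur.\<close>
  have "x div 9 = y div 9 \<or> x div 9 = z div 9" using 3[of x y] 3[of x z] d(1) by argo
  moreover have "x div 9 = y div 9 \<or> y div 9 = z div 9" using 3[of x y] 3[of y z] d(2) by argo
  moreover have "x div 9 = z div 9 \<or> y div 9 = z div 9" using 3[of x z] 3[of y z] d(3) by argo
  ultimately have same: "x div 9 = y div 9" "x div 9 = z div 9" "y div 9 = z div 9" by argo+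
  have 12: "rook u v = 1 \<or> rook u v = 2" if "u div 9 = v div 9" for u v
    using that by (simp add: rook_def)
  show False using 12[OF same(1)] 12[OF same(2)] 12[OF same(3)] d by argo
qed

text \<open>A copy with at most two colours misses some \<open>k\<close>, and its 11 pages would be
  among the at most 10 of \<open>rook_pages\<close>.\<close>

lemma rook_no_book:
  assumes "p \<le> 18" "subgraph H (complete_graph p)" "isomorphic H (book 11)"
  shows "card ((\<lambda>e. rook (Min e) (Max e)) ` edges H) > 2"
proof (rule ccontr)
  let ?f = "\<lambda>e. rook (Min e) (Max e)"
  assume *: "\<not> ?thesis"
  obtain x y Z where B: "x \<noteq> y" "x \<notin> Z" "y \<notin> Z" "{x, y} \<union> Z \<subseteq> verts H" "card Z = 11"
    "{x, y} \<in> edges H" "\<And>z. z \<in> Z \<Longrightarrow> {x, z} \<in> edges H \<and> {y, z} \<in> edges H"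
    using isomorphic_bookE[OF assms(3)] by metis
  have "verts H \<subseteq> {..<18}" using assms(1,2) by (auto simp: subgraph_def complete_graph_def)
  then have lt: "x < 18" "y < 18" "Z \<subseteq> {..<18}" using B(4) by auto
  have finE: "finite (edges H)"
    using assms(2) by (auto simp: subgraph_def complete_graph_def intro: finite_subset)
  have "\<not> {1, 2, 3} \<subseteq> ?f ` edges H"
  proof
    assume "{1, 2, 3} \<subseteq> ?f ` edges H"
    then have "card {1, 2, 3 :: nat} \<le> card (?f ` edges H)" using finE by (intro card_mono) auto
    then show False using * by simp
  qed
  then obtain k where k: "k \<in> {1, 2, 3}" "k \<notin> ?f ` edges H" by blast
  have avoid: "rook u v \<noteq> k" if "{u, v} \<in> edges H" for u v
    using k(2) that rook_Min_Max[of u v] by (metis (no_types, lifting) imageI)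
  have "Z \<subseteq> {z. z < 18 \<and> z \<noteq> x \<and> z \<noteq> y \<and> rook x z \<noteq> k \<and> rook y z \<noteq> k}" (is "_ \<subseteq> ?P")
    using B(2,3) lt(3) avoid[OF conjunct1[OF B(7)]] avoid[OF conjunct2[OF B(7)]] by blast
  moreover have "finite ?P" by simp
  ultimately have "card Z \<le> card ?P" by (rule card_mono[rotated])
  also have "\<dots> \<le> 10" using rook_pages[OF lt(1,2) B(1) k(1) avoid[OF B(6)]] .
  finally have "card Z \<le> 10" .
  then show False using B(5) by simp
qed

section \<open>Transfer to colourings of edge sets and the exact value\<close>

lemma enat_Inf_eqI:
  fixes S :: "nat set"
  assumes "n \<in> S" "\<And>p. p \<in> S \<Longrightarrow> n \<le> p"
  shows "Inf (enat ` S) = enat n"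
  by (rule antisym) (use assms in \<open>auto intro: INF_lower INF_greatest\<close>)

lemma gallai3_coloring:
  assumes "gallai_coloring 3 p f"
  shows "gallai3 {..<p} (\<lambda>x y. f {x, y})"
proof -
  have "f {x, y} \<in> {1, 2, 3}" if "x < p" "y < p" "x \<noteq> y" for x y
  proof -
    have "{x, y} \<in> edges (complete_graph p)" using that by (simp add: complete_graph_def)
    then have "f {x, y} \<in> {1..3}" using assms by (auto simp: gallai_coloring_def coloring_def)
    then show ?thesis by auto
  qed
  moreover have "verts (complete_graph p) = {..<p}" by (simp add: complete_graph_def)
  then have "\<forall>x\<in>{..<p}. \<forall>y\<in>{..<p}. \<forall>z\<in>{..<p}.
      distinct [x, y, z] \<longrightarrow> \<not> distinct [f {x, y}, f {x, z}, f {y, z}]"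
    using assms unfolding gallai_coloring_def rainbow_triangle_def by metis
  ultimately show ?thesis unfolding gallai3_def by (auto simp: insert_commute)
qed

lemma two_colored_book:
  assumes f: "gallai_coloring 3 19 f"
  shows "\<exists>H. subgraph H (complete_graph 19) \<and> isomorphic H (book 11) \<and> card (f ` edges H) \<le> 2"
proof -
  let ?V = "{..<19::nat}" and ?c = "\<lambda>x y. f {x, y}"
  have g: "gallai3 ?V ?c" by (rule gallai3_coloring[OF f])
  then have "\<not> no_book ?V ?c" using book_exists[OF g] by simp
  then obtain k x y where k: "k \<in> {1, 2, 3}" and xy: "x < 19" "y < 19" "x \<noteq> y" "f {x, y} \<noteq> k"
    and small: "card (nbrs ?V ?c k x \<union> nbrs ?V ?c k y) < 7"
    by (auto simp: no_book_def not_le)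
  \<comment> \<open>Spine and excluded vertices: at most 2 + 6 = 8, leaving 11 pages.\<close>
  let ?N = "{x, y} \<union> (nbrs ?V ?c k x \<union> nbrs ?V ?c k y)"
  have "card ?N \<le> 8"
    using card_Un_le[of "{x, y}" "nbrs ?V ?c k x \<union> nbrs ?V ?c k y"] small xy(3) by simp
  moreover have "card (?V - ?N) = 19 - card ?N"
    using xy by (subst card_Diff_subset) (auto simp: nbrs_def)
  ultimately have "11 \<le> card (?V - ?N)" by simp
  then obtain Z where Z: "Z \<subseteq> ?V - ?N" "card Z = 11" "finite Z" by (rule obtain_subset_with_card_n)
  let ?E = "{{x, y}} \<union> (\<lambda>z. {x, z}) ` Z \<union> (\<lambda>z. {y, z}) ` Z"
  let ?H = "\<lparr>verts = {x, y} \<union> Z, edges = ?E\<rparr>"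
  have notin: "x \<notin> Z" "y \<notin> Z" "Z \<subseteq> ?V" using Z(1) by auto
  have E: "?E \<subseteq> edges (complete_graph 19)"
    using xy notin by (auto simp: complete_graph_def card_insert_if)
  have "e \<subseteq> {x, y} \<union> Z \<and> card e = 2" if "e \<in> ?E" for e
    using that subsetD[OF E that] by (auto simp: complete_graph_def)
  then have "simple_graph ?H" using Z(3) by (simp add: simple_graph_def)
  moreover have "verts ?H \<subseteq> verts (complete_graph 19)"
    using xy notin by (auto simp: complete_graph_def)
  ultimately have "subgraph ?H (complete_graph 19)" using E by (simp add: subgraph_def)
  moreover have "isomorphic ?H (book 11)"
    using isomorphic_book[OF Z(3) xy(3) notin(1,2)] Z(2) by simp
  moreover have "card (f ` ?E) \<le> 2"
  proof -
    have "f ` ?E \<subseteq> {1..3}" using E f by (auto simp: gallai_coloring_def coloring_def)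
    moreover have "k \<notin> f ` ?E" using xy(4) Z(1) by (auto simp: nbrs_def)
    ultimately have "f ` ?E \<subseteq> {1..3} - {k}" by blast
    then have "card (f ` ?E) \<le> card ({1..3} - {k})" by (intro card_mono) auto
    also have "\<dots> = 2" using k by auto
    finally show ?thesis .
  qed
  ultimately show ?thesis by (metis graph.select_convs(2))
qed

theorem theorem4p7: "weakened_gallai_ramsey 3 2 (book 11) = 19"
proof -
  have "weakened_gallai_ramsey 3 2 (book 11) = enat 19"
    unfolding weakened_gallai_ramsey_def
  proof (rule enat_Inf_eqI)
    fix p
    assume "p \<in> {p. \<forall>f. gallai_coloring 3 p f \<longrightarrow>
      (\<exists>H. subgraph H (complete_graph p) \<and> isomorphic H (book 11) \<and> card (f ` edges H) \<le> 2)}"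
    then obtain H where H: "subgraph H (complete_graph p)" "isomorphic H (book 11)"
      "card ((\<lambda>e. rook (Min e) (Max e)) ` edges H) \<le> 2"
      using gallai_rook[of p] by blast
    \<comment> \<open>The rook colouring is defined on every complete graph at once, so each
      \<open>p\<close> up to 18 is refuted directly.\<close>
    then have "\<not> p \<le> 18" using rook_no_book[of p H] by linarith
    then show "19 \<le> p" by simp
  qed (use two_colored_book in blast)
  then show ?thesis by (simp add: numeral_eq_enat)
qed

end
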